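(* Let $\mathcal N$ be a $d$-dimensional real normed space. Then \[\kappa'(\mathcal N)\le\kappa(\mathcal N)\le P\!\left(\mathcal N,2\left(1+\tfrac1d\right)\right)(d+O(1))\log d=O(3^d d\log d),\] where the $O(\cdot)$ terms hide absolute constants independent of $d$ and $\mathcal N$.
   Context: Let $K$ be the unit ball of $\mathcal N$ (an $o$-symmetric convex body, i.e. compact convex with non-empty interior and $K=-K$). A positive homothet of $K$ is $\lambda K+v$ with $\lambda>0$, $v\in\mathbb{R}^d$ (center $v$). A Minkowski arrangement of $K$ is a family $\{v_i+\lambda_iK\}$ of positive homothets with $v_i\notin v_j+\lambda_j\,\mathrm{int}(K)$ for all $i\ne j$; a strict one has $v_i\notin v_j+\lambda_jK$ for $i\neq j$. $\kappa(\mathcal N)=\kappa(K)$ (resp. $\kappa'(\mathcal N)$) is the largest size of a pairwise intersecting Minkowski (resp. strict Minkowski) arrangement of $K$. The packing number $P(\mathcal N,\lambda)$ is the maximum number of points in $\mathcal N$ such that the ratio of the maximal pairwise distance to the minimal pairwise distance is at most $\lambda$.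
   Formalization: The dimension d is assumed to be at least 2: for d = 1 the bound P·(d+O(1)) log d equals 0 while κ ≥ 1, so the claim fails there, and for d = 0 the terms 1/d and log d are undefined. *)

theory Defs
  imports "HOL-Analysis.Analysis"
begin

text \<open>The d-dimensional real vector space R^d, represented as functions
  nat => real vanishing from index d on (so that the dimension d can be
  quantified inside a formula).\<close>
definition Rd :: "nat \<Rightarrow> (nat \<Rightarrow> real) set" where
  "Rd d = {x. \<forall>i\<ge>d. x i = 0}"

definition vsub :: "(nat \<Rightarrow> real) \<Rightarrow> (nat \<Rightarrow> real) \<Rightarrow> (nat \<Rightarrow> real)" where
  "vsub x y = (\<lambda>i. x i - y i)"

text \<open>A norm on R^d; (R^d, nrm) is a d-dimensional real normed space, and every
  d-dimensional real normed space is isometric to one of these.\<close>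
definition is_norm_on :: "nat \<Rightarrow> ((nat \<Rightarrow> real) \<Rightarrow> real) \<Rightarrow> bool" where
  "is_norm_on d nrm \<longleftrightarrow>
     (\<forall>x\<in>Rd d. 0 \<le> nrm x \<and> (nrm x = 0 \<longleftrightarrow> x = (\<lambda>_. 0))) \<and>
     (\<forall>x\<in>Rd d. \<forall>c. nrm (\<lambda>i. c * x i) = \<bar>c\<bar> * nrm x) \<and>
     (\<forall>x\<in>Rd d. \<forall>y\<in>Rd d. nrm (\<lambda>i. x i + y i) \<le> nrm x + nrm y)"

definition esize :: "'a set \<Rightarrow> ereal" where
  "esize A = (if finite A then ereal (card A) else \<infinity>)"

text \<open>A family of positive homothets v + r v K of the unit ball K = {x. nrm x \<le> 1},
  indexed by its set of centres A (centres are necessarily distinct in a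
  Minkowski arrangement). int K = {x. nrm x < 1}.\<close>
definition pairwise_intersecting ::
  "nat \<Rightarrow> ((nat \<Rightarrow> real) \<Rightarrow> real) \<Rightarrow> (nat \<Rightarrow> real) set \<Rightarrow> ((nat \<Rightarrow> real) \<Rightarrow> real) \<Rightarrow> bool" where
  "pairwise_intersecting d nrm A r \<longleftrightarrow>
     (\<forall>v\<in>A. \<forall>w\<in>A. \<exists>z\<in>Rd d. nrm (vsub z v) \<le> r v \<and> nrm (vsub z w) \<le> r w)"

definition minkowski_arr ::
  "nat \<Rightarrow> ((nat \<Rightarrow> real) \<Rightarrow> real) \<Rightarrow> (nat \<Rightarrow> real) set \<Rightarrow> ((nat \<Rightarrow> real) \<Rightarrow> real) \<Rightarrow> bool" where
  "minkowski_arr d nrm A r \<longleftrightarrow> A \<subseteq> Rd d \<and> (\<forall>v\<in>A. r v > 0) \<and>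
     (\<forall>v\<in>A. \<forall>w\<in>A. v \<noteq> w \<longrightarrow> \<not> nrm (vsub v w) < r w)"

definition strict_minkowski_arr ::
  "nat \<Rightarrow> ((nat \<Rightarrow> real) \<Rightarrow> real) \<Rightarrow> (nat \<Rightarrow> real) set \<Rightarrow> ((nat \<Rightarrow> real) \<Rightarrow> real) \<Rightarrow> bool" where
  "strict_minkowski_arr d nrm A r \<longleftrightarrow> A \<subseteq> Rd d \<and> (\<forall>v\<in>A. r v > 0) \<and>
     (\<forall>v\<in>A. \<forall>w\<in>A. v \<noteq> w \<longrightarrow> \<not> nrm (vsub v w) \<le> r w)"

definition kappa :: "nat \<Rightarrow> ((nat \<Rightarrow> real) \<Rightarrow> real) \<Rightarrow> ereal" where
  "kappa d nrm = Sup {esize A | A r. minkowski_arr d nrm A r \<and> pairwise_intersecting d nrm A r}"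

definition kappa' :: "nat \<Rightarrow> ((nat \<Rightarrow> real) \<Rightarrow> real) \<Rightarrow> ereal" where
  "kappa' d nrm = Sup {esize A | A r. strict_minkowski_arr d nrm A r \<and> pairwise_intersecting d nrm A r}"

definition packing_number :: "nat \<Rightarrow> ((nat \<Rightarrow> real) \<Rightarrow> real) \<Rightarrow> real \<Rightarrow> ereal" where
  "packing_number d nrm lam = Sup {esize S | S. S \<subseteq> Rd d \<and>
     (\<forall>a\<in>S. \<forall>b\<in>S. \<forall>c\<in>S. \<forall>e\<in>S. a \<noteq> b \<and> c \<noteq> e \<longrightarrow>
        nrm (vsub a b) \<le> lam * nrm (vsub c e))}"

end

theory Submission
  imports Defs
begin

text \<open>Normalise the smallest radius of a pairwise intersecting Minkowski arrangement to 1. The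
  centres whose radii lie in \<open>[c, c (1 + 1/d)]\<close> have pairwise distances in \<open>[c, 2 c (1 + 1/d)]\<close>, so
  there are at most \<open>P\<close> of them, and \<open>(d + O(1)) ln d\<close> such classes exhaust the radii below
  \<open>d + 1\<close>. All homothets of radius at least \<open>d + 1\<close> meet the smallest one, so their centres lie almost
  on the spheres about its centre of the same radii; projected radially to the unit sphere, they stay at
  distance at least \<open>d / (d + 1)\<close> and at most 2, so they number at most \<open>P\<close> as well.

  For the bound on \<open>P\<close>, let \<open>X\<close> be the union of the balls of radius \<open>m/2\<close> about points with minimal
  distance \<open>m\<close> and maximal distance \<open>\<lambda> m\<close>. Then \<open>(X - X)/2\<close> lies in the ball of radius
  \<open>(\<lambda> + 1) m / 2\<close> about the origin and by the Prekopa--Leindler inequality its volume is at least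
  that of \<open>X\<close>; so there are at most \<open>(\<lambda> + 1)\<^sup>d\<close> points.\<close>

section \<open>The Prekopa--Leindler inequality for midpoints\<close>

lemma emeasure_lborel_affine_vimage:
  fixes A :: "real set"
  assumes "A \<in> sets borel" "c \<noteq> 0"
  shows "emeasure lborel A = ennreal \<bar>c\<bar> * emeasure lborel ((\<lambda>x. t + c * x) -` A)"
proof -
  have [measurable]: "A \<in> sets borel" by fact
  have [measurable]: "(\<lambda>x. t + c * x) -` A \<in> sets borel"
    using measurable_sets[of "\<lambda>x. t + c * x" borel borel A] by simp
  have "emeasure lborel A = (\<integral>\<^sup>+x. indicator A x \<partial>lborel)"
    by simp
  also have "\<dots> = ennreal \<bar>c\<bar> * (\<integral>\<^sup>+x. indicator A (t + c * x) \<partial>lborel)"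
    by (rule nn_integral_real_affine) (use assms in auto)
  also have "(\<lambda>x. indicator A (t + c * x) :: ennreal) = indicator ((\<lambda>x. t + c * x) -` A)"
    by (auto simp: indicator_def)
  finally show ?thesis by simp
qed

text \<open>If \<open>a\<close> is close to \<open>Sup A\<close> and \<open>b\<close> to \<open>Inf B\<close>, the translates \<open>A + b\<close> and \<open>a + B\<close>, both contained
  in \<open>C\<close>, overlap only in a short interval.\<close>
lemma emeasure_lborel_sumset_bounded:
  fixes A B C :: "real set"
  assumes [measurable]: "A \<in> sets borel" "B \<in> sets borel" "C \<in> sets borel"
    and ne: "A \<noteq> {}" "B \<noteq> {}" and bdd: "bdd_above A" "bdd_below B"
    and sum: "\<And>x y. x \<in> A \<Longrightarrow> y \<in> B \<Longrightarrow> x + y \<in> C"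
  shows "emeasure lborel A + emeasure lborel B \<le> emeasure lborel C"
proof (rule ennreal_le_epsilon)
  fix e :: real assume e: "0 < e"
  obtain a where a: "a \<in> A" "Sup A - e/2 < a"
    using less_cSupD[OF ne(1), of "Sup A - e/2"] e by auto
  obtain b where b: "b \<in> B" "b < Inf B + e/2"
    using cInf_lessD[OF ne(2), of "Inf B + e/2"] e by auto
  let ?A = "(\<lambda>x. - b + 1 * x) -` A" and ?B = "(\<lambda>x. - a + 1 * x) -` B"
  have mA: "?A \<in> sets lborel" and mB: "?B \<in> sets lborel"
    using measurable_sets[of "\<lambda>x. - b + 1 * x" borel borel A]
      measurable_sets[of "\<lambda>x. - a + 1 * x" borel borel B] by simp_all
  have sub: "?A \<union> ?B \<subseteq> C"
    using sum[of _ b] sum[of a] a b by force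
  have "?A \<inter> ?B \<subseteq> {a + Inf B .. Sup A + b}"
    using cSup_upper[OF _ bdd(1)] cInf_lower[OF _ bdd(2)] by force
  hence "emeasure lborel (?A \<inter> ?B) \<le> emeasure lborel {a + Inf B .. Sup A + b}"
    by (intro emeasure_mono) auto
  also have "\<dots> \<le> ennreal e"
    using a b by (auto intro!: ennreal_leI simp: emeasure_lborel_Icc_eq)
  finally have int: "emeasure lborel (?A \<inter> ?B) \<le> ennreal e" .
  have "emeasure lborel A + emeasure lborel B = emeasure lborel ?A + emeasure lborel ?B"
    using emeasure_lborel_affine_vimage[of A 1 "-b"] emeasure_lborel_affine_vimage[of B 1 "-a"]
    by simp
  also have "\<dots> = emeasure lborel (?A \<union> ?B) + emeasure lborel (?A \<inter> ?B)"
    by (rule emeasure_Un_Int[OF mA mB])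
  also have "\<dots> \<le> emeasure lborel C + ennreal e"
    using sub int by (intro add_mono emeasure_mono) auto
  finally show "emeasure lborel A + emeasure lborel B \<le> emeasure lborel C + ennreal e" .
qed

text \<open>Cutting both sets down to \<open>[-n, n]\<close> reduces this to the bounded case, and
  continuity from below recovers the full measures. The cut sets must be nonempty, which holds once
  \<open>n\<close> exceeds the absolute value of one chosen point from each set.\<close>

lemma emeasure_lborel_sumset:
  fixes A B C :: "real set"
  assumes [measurable]: "A \<in> sets borel" "B \<in> sets borel" "C \<in> sets borel"
    and ne: "A \<noteq> {}" "B \<noteq> {}"
    and sum: "\<And>x y. x \<in> A \<Longrightarrow> y \<in> B \<Longrightarrow> x + y \<in> C"
  shows "emeasure lborel A + emeasure lborel B \<le> emeasure lborel C"
proof -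
  have lim: "(\<lambda>n. emeasure lborel (D \<inter> {-real n..real n})) \<longlonglongrightarrow> emeasure lborel D"
    if [measurable]: "D \<in> sets borel" for D
  proof -
    have "(\<Union>n. D \<inter> {-real n..real n}) = D"
    proof (intro equalityI subsetI)
      fix x assume "x \<in> D"
      moreover obtain n where "\<bar>x\<bar> \<le> real n" using real_arch_simple by blast
      ultimately show "x \<in> (\<Union>n. D \<inter> {-real n..real n})" by (auto simp: abs_le_iff intro!: exI[of _ n])
    qed auto
    moreover have "incseq (\<lambda>n. D \<inter> {-real n..real n})" by (auto simp: incseq_def)
    ultimately show ?thesis
      using Lim_emeasure_incseq[of "\<lambda>n. D \<inter> {-real n..real n}" lborel] by (simp add: image_subset_iff)
  qed
  obtain a b where ab: "a \<in> A" "b \<in> B" using ne by auto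
  obtain N where N: "max \<bar>a\<bar> \<bar>b\<bar> \<le> real N" using real_arch_simple by blast
  have "emeasure lborel (A \<inter> {-real n..real n}) + emeasure lborel (B \<inter> {-real n..real n})
      \<le> emeasure lborel C" if "n \<ge> N" for n
  proof (rule emeasure_lborel_sumset_bounded)
    have "real N \<le> real n" using that by simp
    thus "A \<inter> {-real n..real n} \<noteq> {}" "B \<inter> {-real n..real n} \<noteq> {}"
      using ab N by (auto simp: abs_le_iff intro!: exI[of _ a] exI[of _ b])
  qed (use sum in auto)
  thus ?thesis
    by (intro LIMSEQ_le_const2[OF tendsto_add[OF lim lim]]) auto
qed

lemma emeasure_lborel_midpoints:
  fixes A B C :: "real set"
  assumes [measurable]: "A \<in> sets borel" "B \<in> sets borel" "C \<in> sets borel"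
    and ne: "A \<noteq> {}" "B \<noteq> {}"
    and mid: "\<And>x y. x \<in> A \<Longrightarrow> y \<in> B \<Longrightarrow> (x + y) / 2 \<in> C"
  shows "emeasure lborel A + emeasure lborel B \<le> 2 * emeasure lborel C"
proof -
  \<comment> \<open>This preimage is the dilate \<open>2 C\<close>, which contains
    \<open>A + B\<close>.\<close>
  let ?C = "(\<lambda>x. 0 + (1/2) * x) -` C"
  have C: "?C \<in> sets borel"
    using measurable_sets[of "\<lambda>x. 0 + (1/2) * x" borel borel C] by simp
  have "emeasure lborel A + emeasure lborel B \<le> emeasure lborel ?C"
    by (rule emeasure_lborel_sumset) (use ne mid C in \<open>auto simp: add_divide_distrib\<close>)
  also have "emeasure lborel ?C = 2 * emeasure lborel C"
  proof -
    have "emeasure lborel C = ennreal (1/2) * emeasure lborel ?C"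
      using emeasure_lborel_affine_vimage[of C "1/2" 0] by simp
    hence "2 * emeasure lborel C = (ennreal 2 * ennreal (1/2)) * emeasure lborel ?C"
      by (simp add: mult.assoc)
    also have "ennreal 2 * ennreal (1/2) = 1"
      by (subst ennreal_mult[symmetric]) auto
    finally show ?thesis by simp
  qed
  finally show ?thesis .
qed

section \<open>The functional inequality on the real line, through level sets\<close>

lemma nn_integral_layer_cake:
  fixes f :: "real \<Rightarrow> ennreal"
  assumes [measurable]: "f \<in> borel_measurable borel"
  shows "(\<integral>\<^sup>+x. f x \<partial>lborel) =
    (\<integral>\<^sup>+t. emeasure lborel {x. ennreal t < f x} * indicator {0..} t \<partial>lborel)"
proof -
  let ?I = "\<lambda>x t. indicator {(x, t). 0 \<le> t \<and> ennreal t < f x} (x, t) :: ennreal"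
  \<comment> \<open>Each value of \<open>f\<close> is the length of the interval
    \<open>[0, f x)\<close>, also when it is infinite; exchanging the two integrations then gives
    the formula.\<close>
  have f: "f x = (\<integral>\<^sup>+t. ?I x t \<partial>lborel)" for x
  proof -
    have "(\<integral>\<^sup>+t. ?I x t \<partial>lborel) = (\<integral>\<^sup>+t. indicator {t. 0 \<le> t \<and> ennreal t < f x} t \<partial>lborel)"
      by (simp add: indicator_def)
    also have "\<dots> = emeasure lborel {t. 0 \<le> t \<and> ennreal t < f x}"
      by (intro nn_integral_indicator) measurable
    also have "\<dots> = f x"
    proof (cases "f x")
      case (real r)
      hence "{t. 0 \<le> t \<and> ennreal t < f x} = {0..<r}"
        by (auto simp: ennreal_less_iff)
      thus ?thesis using real by simp
    next
      case top
      hence "{t. 0 \<le> t \<and> ennreal t < f x} = {0..}" by auto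
      moreover have "emeasure lborel {0::real..} = top"
      proof (rule ccontr)
        assume "emeasure lborel {0::real..} \<noteq> top"
        then obtain r where r: "emeasure lborel {0::real..} = ennreal r" "0 \<le> r"
          by (cases "emeasure lborel {0::real..}") auto
        have "emeasure lborel {0..r+1} \<le> emeasure lborel {0::real..}"
          by (intro emeasure_mono) auto
        thus False using r by (simp add: ennreal_le_iff)
      qed
      ultimately show ?thesis using top by simp
    qed
    finally show ?thesis ..
  qed
  have "(\<integral>\<^sup>+x. f x \<partial>lborel) = (\<integral>\<^sup>+x. (\<integral>\<^sup>+t. ?I x t \<partial>lborel) \<partial>lborel)"
    by (simp add: f[symmetric])
  also have "\<dots> = (\<integral>\<^sup>+t. (\<integral>\<^sup>+x. ?I x t \<partial>lborel) \<partial>lborel)"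
    by (rule lborel_pair.Fubini') measurable
  also have "(\<lambda>t. \<integral>\<^sup>+x. ?I x t \<partial>lborel) =
      (\<lambda>t. emeasure lborel {x. ennreal t < f x} * indicator {0..} t)"
  proof
    fix t
    have "(\<integral>\<^sup>+x. ?I x t \<partial>lborel) = (\<integral>\<^sup>+x. indicator {x. ennreal t < f x} x * indicator {0..} t \<partial>lborel)"
      by (auto simp: indicator_def intro!: nn_integral_cong)
    also have "\<dots> = emeasure lborel {x. ennreal t < f x} * indicator {0..} t"
      by (subst nn_integral_multc) auto
    finally show "(\<integral>\<^sup>+x. ?I x t \<partial>lborel) = emeasure lborel {x. ennreal t < f x} * indicator {0..} t" .
  qed
  finally show ?thesis .
qed

text \<open>Since both suprema are 1, the superlevel sets of \<open>f\<close> and \<open>g\<close>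
  at height \<open>t\<close> are nonempty for all \<open>t\<close> in \<open>[0, 1)\<close> and
  empty for \<open>t\<close> at least 1. At the former heights the midpoints of the two level sets
  lie in that of \<open>h\<close>, so the one-dimensional set inequality applies; integrating over
  \<open>t\<close> gives the claim. Without the common supremum one level set could be empty while
  the other is not.\<close>

lemma prekopa_leindler_real_normalised:
  fixes f g h :: "real \<Rightarrow> ennreal"
  assumes [measurable]: "f \<in> borel_measurable borel" "g \<in> borel_measurable borel"
      "h \<in> borel_measurable borel"
    and f: "(SUP x. f x) = 1" and g: "(SUP x. g x) = 1"
    and fgh: "\<And>x y. f x * g y \<le> (h ((x + y) / 2))\<^sup>2"
  shows "(\<integral>\<^sup>+x. f x \<partial>lborel) + (\<integral>\<^sup>+x. g x \<partial>lborel) \<le> 2 * (\<integral>\<^sup>+x. h x \<partial>lborel)"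
proof -
  let ?L = "\<lambda>f t. emeasure lborel {x::real. ennreal t < f x} * indicator {0..} t"
  have [measurable]: "?L f \<in> borel_measurable borel" if [measurable]: "f \<in> borel_measurable borel" for f
    by measurable
  have level: "?L f t + ?L g t \<le> 2 * ?L h t" for t
  proof -
    consider "t < 0" | "1 \<le> t" | "0 \<le> t" "t < 1" by linarith
    thus ?thesis
    proof cases
      case 2
      have "f x \<le> ennreal t" "g x \<le> ennreal t" for x
        using SUP_upper[of x UNIV f] SUP_upper[of x UNIV g] f g 2
        by (metis UNIV_I ennreal_1 ennreal_leI order_trans)+
      thus ?thesis by (simp add: not_less[symmetric])
    next
      case 3
      have "emeasure lborel {x. ennreal t < f x} + emeasure lborel {x. ennreal t < g x}
          \<le> 2 * emeasure lborel {x. ennreal t < h x}"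
      proof (rule emeasure_lborel_midpoints)
        have "ennreal t < 1" using 3 by (metis ennreal_1 ennreal_less_iff)
        thus "{x. ennreal t < f x} \<noteq> {}" "{x. ennreal t < g x} \<noteq> {}"
          using f g less_SUP_iff[of "ennreal t" f UNIV] less_SUP_iff[of "ennreal t" g UNIV] by auto
      next
        fix x y assume "x \<in> {x. ennreal t < f x}" "y \<in> {x. ennreal t < g x}"
        hence xy: "ennreal t < f x" "ennreal t < g y" by auto
        \<comment> \<open>These bounds keep both values finite, so that the two strict inequalities
          can be multiplied as inequalities of reals.\<close>
        have "f x \<le> 1" "g y \<le> 1"
          using SUP_upper[of x UNIV f] SUP_upper[of y UNIV g] f g by auto
        hence "(ennreal t)\<^sup>2 < f x * g y"
          using xy 3 by (cases "f x"; cases "g y") (auto simp: power2_eq_square ennreal_mult[symmetric] ennreal_less_iff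
             mult_strict_mono' top_unique)
        also have "\<dots> \<le> (h ((x + y) / 2))\<^sup>2" by (rule fgh)
        finally show "(x + y) / 2 \<in> {x. ennreal t < h x}"
          using power_mono[of "h ((x + y) / 2)" "ennreal t" 2] by (force simp: not_less)
      qed auto
      thus ?thesis using 3 by simp
    qed simp
  qed
  have "(\<integral>\<^sup>+x. f x \<partial>lborel) + (\<integral>\<^sup>+x. g x \<partial>lborel) = (\<integral>\<^sup>+t. ?L f t + ?L g t \<partial>lborel)"
    by (subst nn_integral_add) (simp_all flip: nn_integral_layer_cake)
  also have "\<dots> \<le> (\<integral>\<^sup>+t. 2 * ?L h t \<partial>lborel)"
    by (intro nn_integral_mono level)
  also have "\<dots> = 2 * (\<integral>\<^sup>+x. h x \<partial>lborel)"
    by (subst nn_integral_cmult) (simp_all flip: nn_integral_layer_cake)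
  finally show ?thesis .
qed

text \<open>The inequality of arithmetic and geometric means, which turns the additive bound of the
  normalised case into the multiplicative one.\<close>

lemma ennreal_mult_le_square:
  fixes a b c :: ennreal
  assumes "a + b \<le> 2 * c"
  shows "a * b \<le> c\<^sup>2"
proof (cases "c = top")
  case False
  then obtain r where r: "c = ennreal r" "0 \<le> r" by (cases c) auto
  have 2: "2 * c = ennreal (2 * r)"
    using r by (simp add: ennreal_mult)
  have "a \<le> 2 * c" "b \<le> 2 * c"
    using assms by (metis add.commute le_iff_add order_trans)+
  then obtain p q where pq: "a = ennreal p" "0 \<le> p" "b = ennreal q" "0 \<le> q"
    unfolding 2 by (cases a; cases b) (auto simp: top_unique)
  have "p + q \<le> 2 * r"
    using assms pq r unfolding 2 by (simp add: ennreal_plus[symmetric] del: ennreal_plus)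
  hence "(p + q)\<^sup>2 \<le> (2 * r)\<^sup>2" using pq by (intro power_mono) auto
  moreover have "0 \<le> (p - q)\<^sup>2" by simp
  ultimately have "p * q \<le> r\<^sup>2" by (simp add: power2_eq_square algebra_simps)
  thus ?thesis
    using pq r by (simp add: ennreal_mult[symmetric] ennreal_power ennreal_leI)
qed (simp add: power2_eq_square ennreal_top_mult)

text \<open>Dividing \<open>f\<close> and \<open>g\<close> by their suprema \<open>m\<close> and
  \<open>l\<close>, and \<open>h\<close> by the geometric mean of \<open>m\<close> and
  \<open>l\<close>, preserves the hypothesis and reaches the normalised case. The factors cancel
  once the sum has been replaced by a product.\<close>

lemma prekopa_leindler_real_bounded:
  fixes f g h :: "real \<Rightarrow> ennreal"
  assumes [measurable]: "f \<in> borel_measurable borel" "g \<in> borel_measurable borel"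
      "h \<in> borel_measurable borel"
    and f: "(SUP x. f x) < top" and g: "(SUP x. g x) < top"
    and fgh: "\<And>x y. f x * g y \<le> (h ((x + y) / 2))\<^sup>2"
  shows "(\<integral>\<^sup>+x. f x \<partial>lborel) * (\<integral>\<^sup>+x. g x \<partial>lborel) \<le> (\<integral>\<^sup>+x. h x \<partial>lborel)\<^sup>2"
proof (cases "(SUP x. f x) = 0 \<or> (SUP x. g x) = 0")
  case True
  hence "(\<forall>x. f x = 0) \<or> (\<forall>x. g x = 0)" by (auto simp: SUP_eq_iff bot_ennreal[symmetric])
  thus ?thesis by auto
next
  case False
  obtain m where m: "(SUP x. f x) = ennreal m" "0 < m"
    using f False by (cases "SUP x. f x") (auto simp: less_le)
  obtain l where l: "(SUP x. g x) = ennreal l" "0 < l"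
    using g False by (cases "SUP x. g x") (auto simp: less_le)
  define s where "s = sqrt (m * l)"
  have s: "0 < s" "s * s = m * l" using m l by (auto simp: s_def)
  have mult_div: "a / ennreal p * (b / ennreal q) = a * b / ennreal (p * q)"
    if "0 < p" "0 < q" for a b p q
    using that by (simp add: divide_ennreal_def inverse_ennreal ennreal_mult[symmetric] mult_ac)
  have "(\<integral>\<^sup>+x. f x / ennreal m \<partial>lborel) + (\<integral>\<^sup>+x. g x / ennreal l \<partial>lborel)
      \<le> 2 * (\<integral>\<^sup>+x. h x / ennreal s \<partial>lborel)"
  proof (rule prekopa_leindler_real_normalised)
    show "(SUP x. f x / ennreal m) = 1" "(SUP x. g x / ennreal l) = 1"
      using m l by (simp_all add: SUP_divide_ennreal[symmetric] ennreal_divide_self)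
    show "f x / ennreal m * (g y / ennreal l) \<le> (h ((x + y) / 2) / ennreal s)\<^sup>2" for x y
      using fgh[of x y] m l s by (simp add: mult_div power2_eq_square divide_right_mono_ennreal)
  qed measurable
  hence "(\<integral>\<^sup>+x. f x \<partial>lborel) / ennreal m + (\<integral>\<^sup>+x. g x \<partial>lborel) / ennreal l
      \<le> 2 * ((\<integral>\<^sup>+x. h x \<partial>lborel) / ennreal s)"
    by (simp add: nn_integral_divide)
  from ennreal_mult_le_square[OF this]
  have "(\<integral>\<^sup>+x. f x \<partial>lborel) * (\<integral>\<^sup>+x. g x \<partial>lborel) / ennreal (m * l)
      \<le> (\<integral>\<^sup>+x. h x \<partial>lborel)\<^sup>2 / ennreal (m * l)"
    using m l s by (simp add: mult_div power2_eq_square)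
  thus ?thesis using m l
    by (simp add: divide_le_posI_ennreal ennreal_divide_times divide_ennreal_def ennreal_mult_le_mult_iff inverse_ennreal mult.commute[of _ "ennreal _"])
qed

text \<open>Truncating \<open>f\<close> and \<open>g\<close> at integer heights only weakens the
  left side of the hypothesis, so \<open>h\<close> may stay as it is; monotone convergence removes
  the truncation.\<close>

lemma prekopa_leindler_real:
  fixes f g h :: "real \<Rightarrow> ennreal"
  assumes [measurable]: "f \<in> borel_measurable borel" "g \<in> borel_measurable borel"
      "h \<in> borel_measurable borel"
    and fgh: "\<And>x y. f x * g y \<le> (h ((x + y) / 2))\<^sup>2"
  shows "(\<integral>\<^sup>+x. f x \<partial>lborel) * (\<integral>\<^sup>+x. g x \<partial>lborel) \<le> (\<integral>\<^sup>+x. h x \<partial>lborel)\<^sup>2"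
proof -
  have lim: "(\<integral>\<^sup>+x. f x \<partial>lborel) = (SUP n. \<integral>\<^sup>+x. min (f x) (of_nat n) \<partial>lborel)"
    if [measurable]: "f \<in> borel_measurable borel" for f :: "real \<Rightarrow> ennreal"
  proof -
    have "(\<integral>\<^sup>+x. (SUP n. min (f x) (of_nat n)) \<partial>lborel) = (SUP n. \<integral>\<^sup>+x. min (f x) (of_nat n) \<partial>lborel)"
      by (rule nn_integral_monotone_convergence_SUP)
        (auto simp: incseq_def le_fun_def min.coboundedI2 intro: order_trans)
    moreover have "(SUP n. min y (of_nat n)) = y" for y :: ennreal
      by (simp add: inf_min[symmetric] inf_SUP[symmetric] ennreal_SUP_of_nat_eq_top)
    ultimately show ?thesis by simp
  qed
  let ?i = "\<lambda>f n. \<integral>\<^sup>+x. min (f x) (of_nat n :: ennreal) \<partial>lborel"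
  have "?i f n * ?i g k \<le> (\<integral>\<^sup>+x. h x \<partial>lborel)\<^sup>2" for n k
  proof (rule prekopa_leindler_real_bounded)
    show "(SUP x. min (f x) (of_nat n)) < top"
      by (rule le_less_trans[OF SUP_least of_nat_less_top[of n]]) simp
    show "(SUP x. min (g x) (of_nat k)) < top"
      by (rule le_less_trans[OF SUP_least of_nat_less_top[of k]]) simp
    show "min (f x) (of_nat n) * min (g y) (of_nat k) \<le> (h ((x + y) / 2))\<^sup>2" for x y
      by (rule order_trans[OF mult_mono fgh]) auto
  qed auto
  hence "(SUP k. SUP n. ?i f n * ?i g k) \<le> (\<integral>\<^sup>+x. h x \<partial>lborel)\<^sup>2"
    by (intro SUP_least)
  thus ?thesis
    by (simp add: lim[OF assms(1)] lim[OF assms(2)] SUP_mult_left_ennreal SUP_mult_right_ennreal)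
qed

section \<open>Passage to finite products of the real line\<close>

interpretation lborel_product: product_sigma_finite "\<lambda>_. lborel :: real measure"
  by standard

text \<open>Induction on the index set. For fixed remaining coordinates, the one-dimensional
  inequality in the new coordinate says exactly that the functions obtained by integrating it out
  satisfy the hypothesis over the smaller index set. The midpoint is restricted to \<open>I\<close>
  so that it is again a point of the product space.\<close>

lemma prekopa_leindler_PiM:
  fixes f g h :: "('i \<Rightarrow> real) \<Rightarrow> ennreal"
  assumes "finite I"
    and "f \<in> borel_measurable (PiM I (\<lambda>_. lborel))" "g \<in> borel_measurable (PiM I (\<lambda>_. lborel))"
      "h \<in> borel_measurable (PiM I (\<lambda>_. lborel))"
    and "\<And>x y. x \<in> extensional I \<Longrightarrow> y \<in> extensional I \<Longrightarrow>
       f x * g y \<le> (h (\<lambda>i\<in>I. (x i + y i) / 2))\<^sup>2"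
  shows "(\<integral>\<^sup>+x. f x \<partial>PiM I (\<lambda>_. lborel)) * (\<integral>\<^sup>+x. g x \<partial>PiM I (\<lambda>_. lborel))
    \<le> (\<integral>\<^sup>+x. h x \<partial>PiM I (\<lambda>_. lborel))\<^sup>2"
  using assms
proof (induction I arbitrary: f g h rule: finite_induct)
  case empty
  thus ?case
    by (simp add: lborel_product.nn_integral_empty restrict_def)
next
  case (insert i I)
  note [measurable] = insert.prems(1-3)
  have fiber: "(\<lambda>y. f (x(i := y))) \<in> borel_measurable borel"
    if "x \<in> extensional I" "f \<in> borel_measurable (PiM (insert i I) (\<lambda>_. lborel))"
    for x and f :: "('i \<Rightarrow> real) \<Rightarrow> ennreal"
  proof -
    have "x \<in> space (PiM I (\<lambda>_. lborel))" using that by (simp add: space_PiM PiE_def)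
    from measurable_comp[OF measurable_component_update[OF this insert.hyps(2)] that(2)]
    show ?thesis by (simp add: comp_def)
  qed
  have fun_upd_in_extensional: "x(i := u) \<in> extensional (insert i I)" if "x \<in> extensional I"
    for x :: "'i \<Rightarrow> real" and u
    using that by (auto simp: extensional_def)
  have slice: "(\<lambda>x. \<integral>\<^sup>+u. f (x(i := u)) \<partial>lborel) \<in> borel_measurable (PiM I (\<lambda>_. lborel))"
    if "f \<in> borel_measurable (PiM (insert i I) (\<lambda>_. lborel))"
    for f :: "('i \<Rightarrow> real) \<Rightarrow> ennreal"
    using measurable_comp[OF measurable_add_dim that]
    by (intro lborel.borel_measurable_nn_integral) (simp add: comp_def case_prod_unfold)
  show ?case
    unfolding lborel_product.product_nn_integral_insert[OF insert.hyps(1,2) insert.prems(1)]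
      lborel_product.product_nn_integral_insert[OF insert.hyps(1,2) insert.prems(2)]
      lborel_product.product_nn_integral_insert[OF insert.hyps(1,2) insert.prems(3)]
  proof (rule insert.IH)
    fix x y :: "'i \<Rightarrow> real" assume xy: "x \<in> extensional I" "y \<in> extensional I"
    show "(\<integral>\<^sup>+u. f (x(i := u)) \<partial>lborel) * (\<integral>\<^sup>+u. g (y(i := u)) \<partial>lborel)
      \<le> (\<integral>\<^sup>+u. h ((\<lambda>j\<in>I. (x j + y j) / 2)(i := u)) \<partial>lborel)\<^sup>2"
    proof (rule prekopa_leindler_real)
      fix u v
      have *: "(\<lambda>j\<in>insert i I. ((x(i := u)) j + (y(i := v)) j) / 2)
          = (\<lambda>j\<in>I. (x j + y j) / 2)(i := (u + v) / 2)"
        using insert.hyps(2) by (auto simp: fun_eq_iff restrict_def)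
      show "f (x(i := u)) * g (y(i := v)) \<le> (h ((\<lambda>j\<in>I. (x j + y j) / 2)(i := (u + v) / 2)))\<^sup>2"
        using insert.prems(4)[OF fun_upd_in_extensional[OF xy(1), of u]
          fun_upd_in_extensional[OF xy(2), of v]] unfolding * .
      show "(\<lambda>u. h ((\<lambda>j\<in>I. (x j + y j) / 2)(i := u))) \<in> borel_measurable borel"
        by (rule fiber[OF restrict_extensional insert.prems(3)])
    qed (rule fiber[OF xy(1) insert.prems(1)] fiber[OF xy(2) insert.prems(2)])+
  qed (rule slice[OF insert.prems(1)] slice[OF insert.prems(2)] slice[OF insert.prems(3)])+
qed

text \<open>The pushforward under the affine map, rescaled by the determinant, agrees with the
  product measure on boxes, where the claim splits into one-dimensional ones; hence the two measures
  coincide.\<close>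

lemma emeasure_PiM_lborel_affine_vimage:
  assumes I: "finite I" and A: "A \<in> sets (PiM I (\<lambda>_. lborel :: real measure))" and c: "c \<noteq> 0"
  shows "emeasure (PiM I (\<lambda>_. lborel)) A = ennreal (\<bar>c\<bar> ^ card I) *
    emeasure (PiM I (\<lambda>_. lborel)) ((\<lambda>x. \<lambda>i\<in>I. t i + c * x i) -` A \<inter> space (PiM I (\<lambda>_. lborel)))"
proof -
  let ?M = "PiM I (\<lambda>_. lborel :: real measure)"
  let ?T = "\<lambda>x. \<lambda>i\<in>I. t i + c * x i"
  have T: "?T \<in> measurable ?M ?M" by measurable
  have "scale_measure (ennreal (\<bar>c\<bar> ^ card I)) (distr ?M ?M ?T) = ?M"
  proof (rule lborel_product.PiM_eqI[OF I])
    fix A :: "'a \<Rightarrow> real set" assume A: "\<And>i. i \<in> I \<Longrightarrow> A i \<in> sets lborel"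
    have vA: "(\<lambda>x. t i + c * x) -` A i \<in> sets lborel" if "i \<in> I" for i
      using measurable_sets[of "\<lambda>x. t i + c * x" borel borel "A i"] A[OF that] by simp
    have "?T -` (Pi\<^sub>E I A) \<inter> space ?M = Pi\<^sub>E I (\<lambda>i. (\<lambda>x. t i + c * x) -` A i)"
      by (auto simp: space_PiM PiE_iff)
    moreover have "Pi\<^sub>E I A \<in> sets ?M" using A I by (intro sets_PiM_I_finite) auto
    ultimately have "emeasure (scale_measure (ennreal (\<bar>c\<bar> ^ card I)) (distr ?M ?M ?T)) (Pi\<^sub>E I A)
      = ennreal (\<bar>c\<bar> ^ card I) * emeasure ?M (Pi\<^sub>E I (\<lambda>i. (\<lambda>x. t i + c * x) -` A i))"
      using T by (simp add: emeasure_distr)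
    also have "\<dots> = ennreal \<bar>c\<bar> ^ card I * (\<Prod>i\<in>I. emeasure lborel ((\<lambda>x. t i + c * x) -` A i))"
      using I vA by (subst lborel_product.emeasure_PiM) (auto simp: ennreal_power)
    also have "\<dots> = (\<Prod>i\<in>I. ennreal \<bar>c\<bar> * emeasure lborel ((\<lambda>x. t i + c * x) -` A i))"
      by (simp add: prod.distrib)
    also have "\<dots> = (\<Prod>i\<in>I. emeasure lborel (A i))"
      using A c by (intro prod.cong refl emeasure_lborel_affine_vimage[symmetric]) auto
    finally show "emeasure (scale_measure (ennreal (\<bar>c\<bar> ^ card I)) (distr ?M ?M ?T)) (Pi\<^sub>E I A)
      = (\<Prod>i\<in>I. emeasure lborel (A i))" .
  qed simp
  hence "emeasure ?M A = emeasure (scale_measure (ennreal (\<bar>c\<bar> ^ card I)) (distr ?M ?M ?T)) A"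
    by simp
  also have "\<dots> = ennreal (\<bar>c\<bar> ^ card I) * emeasure ?M (?T -` A \<inter> space ?M)"
    using T A by (simp add: emeasure_distr)
  finally show ?thesis .
qed

section \<open>Volume bound for separated sets\<close>

text \<open>Points of the product space over \<open>{..<d}\<close> take the value
  \<open>undefined\<close> from index \<open>d\<close> on, whereas points of \<open>Rd d\<close>
  vanish there. This map leads from the former to the latter.\<close>

definition trunc :: "nat \<Rightarrow> (nat \<Rightarrow> real) \<Rightarrow> nat \<Rightarrow> real" where
  "trunc d x = (\<lambda>i. if i < d then x i else 0)"

lemma trunc_in_Rd: "trunc d x \<in> Rd d"
  by (simp add: trunc_def Rd_def)

lemma trunc_Rd: "x \<in> Rd d \<Longrightarrow> trunc d x = x"
  by (auto simp: trunc_def Rd_def fun_eq_iff)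

lemma vsub_trunc: "vsub (trunc d x) (trunc d y) = trunc d (vsub x y)"
  by (auto simp: trunc_def vsub_def)

lemma Rd_scale: "x \<in> Rd d \<Longrightarrow> (\<lambda>i. c * x i) \<in> Rd d"
  by (simp add: Rd_def)

lemma vsub_in_Rd: "x \<in> Rd d \<Longrightarrow> y \<in> Rd d \<Longrightarrow> vsub x y \<in> Rd d"
  by (simp add: Rd_def vsub_def)

section \<open>Comparison of the norm with the sum of absolute coordinates\<close>

locale norm_on_Rd =
  fixes d :: nat and nrm :: "(nat \<Rightarrow> real) \<Rightarrow> real"
  assumes is_norm: "is_norm_on d nrm"
begin

lemma nrm_nonneg: "x \<in> Rd d \<Longrightarrow> 0 \<le> nrm x"
  and nrm_eq_0_iff: "x \<in> Rd d \<Longrightarrow> nrm x = 0 \<longleftrightarrow> x = (\<lambda>_. 0)"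
  and nrm_scale: "x \<in> Rd d \<Longrightarrow> nrm (\<lambda>i. c * x i) = \<bar>c\<bar> * nrm x"
  and nrm_triangle: "x \<in> Rd d \<Longrightarrow> y \<in> Rd d \<Longrightarrow> nrm (\<lambda>i. x i + y i) \<le> nrm x + nrm y"
  using is_norm by (auto simp: is_norm_on_def)

lemma nrm_0: "nrm (\<lambda>_. 0) = 0"
  using nrm_eq_0_iff[of "\<lambda>_. 0"] by (simp add: Rd_def)

lemma nrm_vsub_commute:
  assumes "x \<in> Rd d" "y \<in> Rd d"
  shows "nrm (vsub x y) = nrm (vsub y x)"
  using nrm_scale[OF vsub_in_Rd[OF assms], of "-1"] by (simp add: vsub_def)

lemma nrm_vsub_eq_0_iff:
  "x \<in> Rd d \<Longrightarrow> y \<in> Rd d \<Longrightarrow> nrm (vsub x y) = 0 \<longleftrightarrow> x = y"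
  using nrm_eq_0_iff[OF vsub_in_Rd] by (auto simp: vsub_def fun_eq_iff)

lemma nrm_vsub_triangle:
  assumes "x \<in> Rd d" "y \<in> Rd d" "z \<in> Rd d"
  shows "nrm (vsub x z) \<le> nrm (vsub x y) + nrm (vsub y z)"
  using nrm_triangle[OF vsub_in_Rd[OF assms(1,2)] vsub_in_Rd[OF assms(2,3)]]
  by (simp add: vsub_def)

text \<open>The triangle inequality for the expansion in unit vectors. The induction adds one
  coordinate at a time and stops at \<open>d\<close>, so that all partial sums stay in
  \<open>Rd d\<close>.\<close>

lemma nrm_trunc_le:
  "nrm (trunc d x) \<le> (\<Sum>i<d. \<bar>x i\<bar> * nrm (\<lambda>j. if j = i then 1 else 0))"
proof -
  have "nrm (trunc n x) \<le> (\<Sum>i<n. \<bar>x i\<bar> * nrm (\<lambda>j. if j = i then 1 else 0))" if "n \<le> d" for n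
    using that
  proof (induction n)
    case 0
    thus ?case by (simp add: trunc_def nrm_0)
  next
    case (Suc n)
    let ?e = "\<lambda>j. if j = n then 1 else 0 :: real"
    have e: "?e \<in> Rd d" using Suc.prems by (simp add: Rd_def)
    have xe: "(\<lambda>j. x n * ?e j) \<in> Rd d" using Suc.prems by (simp add: Rd_def)
    have tn: "trunc n x \<in> Rd d" using Suc.prems by (simp add: Rd_def trunc_def)
    have "trunc (Suc n) x = (\<lambda>j. trunc n x j + x n * ?e j)"
      by (auto simp: trunc_def fun_eq_iff less_Suc_eq)
    hence "nrm (trunc (Suc n) x) \<le> nrm (trunc n x) + \<bar>x n\<bar> * nrm ?e"
      using nrm_triangle[OF tn xe] nrm_scale[OF e] by simp
    thus ?case using Suc by simp
  qed
  thus ?thesis by simp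
qed

text \<open>By the triangle inequality the norm changes by at most a weighted sum of coordinate
  differences. Composing with \<open>trunc\<close> gives a function on the whole product topology,
  fit both for the compactness argument below and for Borel measurability.\<close>

lemma continuous_on_nrm_trunc: "continuous_on UNIV (\<lambda>x. nrm (trunc d x))"
proof (unfold continuous_on_def, intro ballI)
  fix x :: "nat \<Rightarrow> real"
  let ?g = "\<lambda>y. \<Sum>i<d. \<bar>y i - x i\<bar> * nrm (\<lambda>j. if j = i then 1 else 0)"
  have coord: "((\<lambda>y::nat \<Rightarrow> real. y i) \<longlongrightarrow> x i) (at x)" for i
    using continuous_on_product_coordinates[of i, where 'b=real] by (simp add: continuous_on_def)
  have "(?g \<longlongrightarrow> (\<Sum>i<d. \<bar>x i - x i\<bar> * nrm (\<lambda>j. if j = i then 1 else 0))) (at x)"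
    by (intro tendsto_intros coord)
  hence g: "(?g \<longlongrightarrow> 0) (at x)" by simp
  have "norm (nrm (trunc d y) - nrm (trunc d x)) \<le> ?g y" for y
  proof -
    have "nrm (trunc d y) \<le> nrm (trunc d x) + nrm (vsub (trunc d y) (trunc d x))"
      using nrm_triangle[OF trunc_in_Rd vsub_in_Rd[OF trunc_in_Rd trunc_in_Rd], of x y x]
      by (simp add: vsub_def)
    moreover have "nrm (trunc d x) \<le> nrm (trunc d y) + nrm (vsub (trunc d x) (trunc d y))"
      using nrm_triangle[OF trunc_in_Rd vsub_in_Rd[OF trunc_in_Rd trunc_in_Rd], of y x y]
      by (simp add: vsub_def)
    moreover have "nrm (vsub (trunc d y) (trunc d x)) \<le> ?g y"
      using nrm_trunc_le[of "vsub y x"] by (simp add: vsub_trunc) (simp add: vsub_def)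
    ultimately show ?thesis
      by (simp add: nrm_vsub_commute[OF trunc_in_Rd trunc_in_Rd, of x y])
  qed
  hence "((\<lambda>y. nrm (trunc d y) - nrm (trunc d x)) \<longlongrightarrow> 0) (at x)"
    by (intro Lim_null_comparison[OF _ g]) auto
  thus "((\<lambda>x. nrm (trunc d x)) \<longlongrightarrow> nrm (trunc d x)) (at x)"
    by (rule LIM_zero_cancel)
qed

text \<open>The constant is the minimum of the norm over the unit sphere of the coordinate-sum norm,
  attained by compactness; homogeneity extends the bound to all of \<open>Rd d\<close>. It serves to
  show that the unit ball has finite volume.\<close>

lemma nrm_lower_bound:
  obtains c where "c > 0" "\<And>x. x \<in> Rd d \<Longrightarrow> c * (\<Sum>i<d. \<bar>x i\<bar>) \<le> nrm x"
proof -
  let ?s = "\<lambda>x::nat \<Rightarrow> real. \<Sum>i<d. \<bar>x i\<bar>"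
  \<comment> \<open>The cube of side 2, with the remaining coordinates pinned to 0: a product of
    compact sets, hence compact, and a subset of \<open>Rd d\<close>.\<close>
  define T :: "(nat \<Rightarrow> real) set" where "T = Pi\<^sub>E UNIV (\<lambda>i. if i < d then {-1..1} else {0})"
  have "compactin (product_topology (\<lambda>_. euclidean) UNIV) T"
    unfolding T_def by (subst compactin_PiE) auto
  hence "compact T" by (simp add: euclidean_product_topology)
  moreover have "continuous_on UNIV ?s"
    by (intro continuous_intros continuous_on_product_coordinates)
  hence "closed (?s -` {1})"
    by (intro continuous_closed_vimage) (auto simp: continuous_on_eq_continuous_at)
  ultimately have comp: "compact (T \<inter> ?s -` {1})" by blast
  have normalised: "(\<lambda>i. x i / ?s x) \<in> T \<inter> ?s -` {1}" if x: "x \<in> Rd d" "?s x > 0" for x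
  proof -
    have "\<bar>x i\<bar> \<le> ?s x" if "i < d" for i
      using member_le_sum[of i "{..<d}" "\<lambda>i. \<bar>x i\<bar>"] that by simp
    hence "\<bar>x i / ?s x\<bar> \<le> 1" if "i < d" for i using that x by simp
    hence "- 1 \<le> x i / ?s x \<and> x i / ?s x \<le> 1" if "i < d" for i
      using that by (meson abs_le_D1 abs_le_D2 minus_le_iff)
    hence "(\<lambda>i. x i / ?s x) \<in> T"
      using x by (auto simp: T_def Rd_def)
    moreover have "?s (\<lambda>i. x i / ?s x) = (\<Sum>i<d. \<bar>x i\<bar> / ?s x)"
      using x by (intro sum.cong) auto
    hence "?s (\<lambda>i. x i / ?s x) = 1"
      using x by (simp add: sum_divide_distrib[symmetric])
    ultimately show ?thesis by simp
  qed
  have s_nonneg: "0 \<le> ?s x" for x by (simp add: sum_nonneg)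
  show ?thesis
  proof (cases "T \<inter> ?s -` {1} = {}")
    \<comment> \<open>If the sphere is empty, all coordinate sums vanish and any positive constant
      will do.\<close>
    case True
    have "?s x = 0" if "x \<in> Rd d" for x
      using normalised[OF that] s_nonneg[of x] unfolding True by (auto simp: less_le)
    thus ?thesis using that[of 1] nrm_nonneg by auto
  next
    case False
    from continuous_attains_inf[OF comp False continuous_on_subset[OF continuous_on_nrm_trunc subset_UNIV]]
    obtain z where z: "z \<in> T" "?s z = 1"
      "\<And>y. y \<in> T \<Longrightarrow> ?s y = 1 \<Longrightarrow> nrm (trunc d z) \<le> nrm (trunc d y)" by auto
    have T_Rd: "T \<subseteq> Rd d"
    proof
      fix x assume "x \<in> T"
      hence "x i \<in> (if i < d then {-1..1} else {0})" for i
        unfolding T_def by (rule PiE_mem) simp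
      hence "x i = 0" if "\<not> i < d" for i using that by (metis singletonD)
      thus "x \<in> Rd d" by (simp add: Rd_def)
    qed
    have "z \<noteq> (\<lambda>_. 0)" using z by auto
    hence pos: "0 < nrm z" using nrm_eq_0_iff[of z] nrm_nonneg[of z] z(1) T_Rd by (auto simp: less_le)
    have "nrm z * ?s x \<le> nrm x" if x: "x \<in> Rd d" for x
    proof (cases "?s x = 0")
      case True
      thus ?thesis using nrm_nonneg[OF x] by simp
    next
      case False
      hence sx: "?s x > 0" using s_nonneg[of x] by linarith
      have "nrm z \<le> nrm (\<lambda>i. x i / ?s x)"
        using z(3)[of "\<lambda>i. x i / ?s x"] normalised[OF x sx] T_Rd z(1) by (simp add: trunc_Rd subset_iff)
      also have "\<dots> = nrm x / ?s x"
        using nrm_scale[OF x, of "1 / ?s x"] sx by simp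
      finally show ?thesis using sx by (simp add: field_simps)
    qed
    thus ?thesis using that pos by blast
  qed
qed

section \<open>Volumes of norm balls\<close>

abbreviation M where "M \<equiv> PiM {..<d} (\<lambda>_. lborel :: real measure)"

text \<open>The balls live in the product measure space, while their centres live in
  \<open>Rd d\<close>. They are open so that balls of radius \<open>m/2\<close> about points at
  distance \<open>m\<close> are disjoint.\<close>

definition nball :: "(nat \<Rightarrow> real) \<Rightarrow> real \<Rightarrow> (nat \<Rightarrow> real) set" where
  "nball s r = {x \<in> space M. nrm (vsub (trunc d x) s) < r}"

text \<open>The map into sequences is measurable coordinate by coordinate, and on a countable
  product the product sigma-algebra is the Borel one, so the continuity of the norm can be
  used.\<close>

lemma nball_sets:
  assumes s: "s \<in> Rd d"
  shows "nball s r \<in> sets M"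
proof -
  have "(\<lambda>x. vsub (trunc d x) s) \<in> measurable M (PiM UNIV (\<lambda>_. borel))"
  proof (rule measurable_PiM_single')
    fix i :: nat
    show "(\<lambda>x. vsub (trunc d x) s i) \<in> borel_measurable M"
      by (cases "i < d") (simp_all add: vsub_def trunc_def)
  qed auto
  hence 1: "(\<lambda>x. vsub (trunc d x) s) \<in> borel_measurable M"
    by (simp add: measurable_cong_sets[OF refl sets_PiM_equal_borel])
  have "(\<lambda>x. nrm (trunc d (vsub (trunc d x) s))) \<in> borel_measurable M"
    by (rule borel_measurable_continuous_on[OF continuous_on_nrm_trunc 1])
  hence "(\<lambda>x. nrm (vsub (trunc d x) s)) \<in> borel_measurable M"
    by (simp add: trunc_Rd[OF vsub_in_Rd[OF trunc_in_Rd s]])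
  thus ?thesis unfolding nball_def by measurable
qed

lemma emeasure_nball:
  assumes s: "s \<in> Rd d" and r: "r > 0"
  shows "emeasure M (nball s r) = ennreal (r ^ d) * emeasure M (nball (\<lambda>_. 0) 1)"
proof -
  have "(\<lambda>x. \<lambda>i\<in>{..<d}. s i + r * x i) -` nball s r \<inter> space M = nball (\<lambda>_. 0) 1"
  proof -
    have "nrm (vsub (trunc d (\<lambda>i\<in>{..<d}. s i + r * x i)) s) = r * nrm (vsub (trunc d x) (\<lambda>_. 0))" for x
    proof -
      have "vsub (trunc d (\<lambda>i\<in>{..<d}. s i + r * x i)) s = (\<lambda>i. r * trunc d x i)"
        using s by (auto simp: vsub_def trunc_def Rd_def fun_eq_iff)
      thus ?thesis using nrm_scale[OF trunc_in_Rd, of r x] r by (simp add: vsub_def)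
    qed
    thus ?thesis using r by (auto simp: nball_def space_PiM)
  qed
  thus ?thesis
    using emeasure_PiM_lborel_affine_vimage[OF _ nball_sets[OF s, of r], of r s] r by simp
qed

lemma emeasure_nball_pos: "emeasure M (nball (\<lambda>_. 0) 1) > 0"
proof -
  \<comment> \<open>The cube with half side \<open>1/K\<close> fits into the unit ball: there the
    norm is at most \<open>(K - 1) / K\<close>. The added 1 makes \<open>K\<close> positive and this
    bound strictly less than 1.\<close>
  define K where "K = (\<Sum>i<d. nrm (\<lambda>j. if j = i then 1 else 0)) + 1"
  have e: "(\<lambda>j. if j = i then 1 else 0) \<in> Rd d" if "i < d" for i using that by (simp add: Rd_def)
  have K: "K > 0" unfolding K_def by (intro add_nonneg_pos sum_nonneg nrm_nonneg e) auto
  have "Pi\<^sub>E {..<d} (\<lambda>_. {-1/K..1/K}) \<subseteq> nball (\<lambda>_. 0) 1"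
  proof
    fix x assume x: "x \<in> Pi\<^sub>E {..<d} (\<lambda>_. {-1/K..1/K})"
    have "\<bar>x i\<bar> \<le> 1 / K" if "i < d" for i
      using PiE_mem[OF x, of i] that by (auto simp: abs_le_iff)
    hence "(\<Sum>i<d. \<bar>x i\<bar> * nrm (\<lambda>j. if j = i then 1 else 0))
        \<le> (\<Sum>i<d. 1 / K * nrm (\<lambda>j. if j = i then 1 else 0))"
      by (intro sum_mono mult_right_mono nrm_nonneg e) auto
    also have "\<dots> = (K - 1) / K" by (simp add: K_def sum_distrib_left[symmetric] sum_divide_distrib[symmetric])
    also have "\<dots> < 1" using K by simp
    finally have "nrm (trunc d x) < 1" using nrm_trunc_le[of x] by linarith
    thus "x \<in> nball (\<lambda>_. 0) 1" using x by (auto simp: nball_def space_PiM vsub_def PiE_iff)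
  qed
  hence "emeasure M (Pi\<^sub>E {..<d} (\<lambda>_. {-1/K..1/K})) \<le> emeasure M (nball (\<lambda>_. 0) 1)"
    by (intro emeasure_mono nball_sets) (auto simp: Rd_def)
  moreover have "emeasure M (Pi\<^sub>E {..<d} (\<lambda>_. {-1/K..1/K})) = ennreal ((2 / K) ^ d)"
    using K by (subst lborel_product.emeasure_PiM) (auto simp: ennreal_power)
  ultimately show ?thesis
    using K by (metis divide_pos_pos ennreal_less_zero_iff order_less_le_trans zero_less_numeral zero_less_power)
qed

lemma emeasure_nball_finite: "emeasure M (nball (\<lambda>_. 0) 1) < top"
proof -
  obtain c where c: "c > 0" "\<And>x. x \<in> Rd d \<Longrightarrow> c * (\<Sum>i<d. \<bar>x i\<bar>) \<le> nrm x"
    using nrm_lower_bound by blast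
  have "nball (\<lambda>_. 0) 1 \<subseteq> Pi\<^sub>E {..<d} (\<lambda>_. {-1/c..1/c})"
  proof
    fix x assume x: "x \<in> nball (\<lambda>_. 0) 1"
    have "\<bar>x i\<bar> \<le> 1 / c" if "i < d" for i
    proof -
      have "c * \<bar>x i\<bar> \<le> c * (\<Sum>i<d. \<bar>trunc d x i\<bar>)"
        using member_le_sum[of i "{..<d}" "\<lambda>i. \<bar>trunc d x i\<bar>"] that c(1) by (simp add: trunc_def)
      also have "\<dots> \<le> nrm (trunc d x)" by (intro c trunc_in_Rd)
      also have "\<dots> \<le> 1" using x by (simp add: nball_def vsub_def)
      finally show ?thesis using c(1) by (simp add: field_simps)
    qed
    hence "- (1 / c) \<le> x i \<and> x i \<le> 1 / c" if "i < d" for i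
      using that by (meson abs_le_D1 abs_le_D2 minus_le_iff)
    thus "x \<in> Pi\<^sub>E {..<d} (\<lambda>_. {-1/c..1/c})"
      using x by (auto simp: nball_def space_PiM PiE_iff)
  qed
  hence "emeasure M (nball (\<lambda>_. 0) 1) \<le> emeasure M (Pi\<^sub>E {..<d} (\<lambda>_. {-1/c..1/c}))"
    by (intro emeasure_mono sets_PiM_I_finite) auto
  also have "\<dots> < top"
    using c(1) by (subst lborel_product.emeasure_PiM) (auto simp: ennreal_power)
  finally show ?thesis .
qed

lemma emeasure_UN_nball:
  assumes S: "finite S" "S \<subseteq> Rd d" and m: "m > 0"
    and sep: "\<And>a b. a \<in> S \<Longrightarrow> b \<in> S \<Longrightarrow> a \<noteq> b \<Longrightarrow> m \<le> nrm (vsub a b)"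
  shows "emeasure M (\<Union>s\<in>S. nball s (m/2)) = ennreal (card S * (m/2) ^ d) * emeasure M (nball (\<lambda>_. 0) 1)"
proof -
  have "disjoint_family_on (\<lambda>s. nball s (m/2)) S"
  proof (unfold disjoint_family_on_def, intro ballI impI)
    fix a b assume ab: "a \<in> S" "b \<in> S" "a \<noteq> b"
    have R: "a \<in> Rd d" "b \<in> Rd d" using ab S by auto
    have False if x: "x \<in> nball a (m/2)" "x \<in> nball b (m/2)" for x
    proof -
      have "m \<le> nrm (vsub a b)" by (rule sep) fact+
      also have "\<dots> \<le> nrm (vsub a (trunc d x)) + nrm (vsub (trunc d x) b)"
        by (intro nrm_vsub_triangle R trunc_in_Rd)
      also have "nrm (vsub a (trunc d x)) = nrm (vsub (trunc d x) a)"
        by (intro nrm_vsub_commute R trunc_in_Rd)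
      finally show False using x by (simp add: nball_def)
    qed
    thus "nball a (m/2) \<inter> nball b (m/2) = {}" by blast
  qed
  hence "emeasure M (\<Union>s\<in>S. nball s (m/2)) = (\<Sum>s\<in>S. emeasure M (nball s (m/2)))"
    using S by (intro sum_emeasure[symmetric]) (auto intro: nball_sets)
  also have "\<dots> = (\<Sum>s\<in>S. ennreal ((m/2) ^ d) * emeasure M (nball (\<lambda>_. 0) 1))"
    using S m by (intro sum.cong emeasure_nball) auto
  also have "\<dots> = ennreal (card S * (m/2) ^ d) * emeasure M (nball (\<lambda>_. 0) 1)"
    using m by (simp add: ennreal_mult ennreal_of_nat_eq_real_of_nat mult.assoc)
  finally show ?thesis .
qed

text \<open>Comparing the union of balls with the whole ball of radius \<open>L + m / 2\<close> would lose a
  factor exponential in \<open>d\<close>; instead the Prekopa--Leindler inequality compares it with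
  half its difference body.\<close>
lemma card_separated_le:
  assumes S: "finite S" "S \<subseteq> Rd d" and m: "m > 0" and L: "L \<ge> 0"
    and sep: "\<And>a b. a \<in> S \<Longrightarrow> b \<in> S \<Longrightarrow> a \<noteq> b \<Longrightarrow> m \<le> nrm (vsub a b)"
    and diam: "\<And>a b. a \<in> S \<Longrightarrow> b \<in> S \<Longrightarrow> nrm (vsub a b) \<le> L"
  shows "real (card S) \<le> (L / m + 1) ^ d"
proof -
  let ?neg = "\<lambda>(s::nat \<Rightarrow> real) i. - s i"
  let ?v = "emeasure M (nball (\<lambda>_. 0) 1)"
  \<comment> \<open>\<open>?Y\<close> is the reflection of \<open>?X\<close>, built as a union of
    balls about the reflected centres; these have the same separation, so its volume comes from the
    same lemma.\<close>
  let ?X = "\<Union>s\<in>S. nball s (m/2)" and ?Y = "\<Union>s\<in>?neg ` S. nball s (m/2)"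
  let ?Z = "nball (\<lambda>_. 0) ((L + m) / 2)"
  have inj: "inj_on ?neg S" by (auto simp: inj_on_def fun_eq_iff)
  have neg_Rd: "?neg ` S \<subseteq> Rd d" using S by (auto simp: Rd_def)
  have 0: "(\<lambda>_. 0) \<in> Rd d" by (simp add: Rd_def)
  have X: "emeasure M ?X = ennreal (card S * (m/2) ^ d) * ?v"
    by (rule emeasure_UN_nball) (use S m sep in auto)
  have Y: "emeasure M ?Y = ennreal (card S * (m/2) ^ d) * ?v"
  proof (subst card_image[OF inj, symmetric], rule emeasure_UN_nball[OF _ neg_Rd m])
    fix a b assume "a \<in> ?neg ` S" "b \<in> ?neg ` S" "a \<noteq> b"
    then obtain a' b' where "a = ?neg a'" "b = ?neg b'" "a' \<in> S" "b' \<in> S" "a' \<noteq> b'" by auto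
    thus "m \<le> nrm (vsub a b)" using sep[of b' a'] by (simp add: vsub_def)
  qed (use S in auto)
  have Z: "emeasure M ?Z = ennreal (((L + m)/2) ^ d) * ?v"
    by (rule emeasure_nball[OF 0]) (use L m in auto)
  have meas: "?X \<in> sets M" "?Y \<in> sets M" "?Z \<in> sets M"
    using S neg_Rd 0 by (auto intro!: sets.finite_UN nball_sets)
  have "(\<integral>\<^sup>+x. indicator ?X x \<partial>M) * (\<integral>\<^sup>+x. indicator ?Y x \<partial>M) \<le> (\<integral>\<^sup>+x. indicator ?Z x \<partial>M)\<^sup>2"
  proof (rule prekopa_leindler_PiM)
    fix x y :: "nat \<Rightarrow> real" assume xy: "x \<in> extensional {..<d}" "y \<in> extensional {..<d}"
    have "(\<lambda>i\<in>{..<d}. (x i + y i) / 2) \<in> ?Z" if in_X: "x \<in> ?X" and in_Y: "y \<in> ?Y"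
    proof -
      obtain a b where ab: "a \<in> S" "b \<in> S" "x \<in> nball a (m/2)" "y \<in> nball (?neg b) (m/2)"
        using in_X in_Y by blast
      have R: "a \<in> Rd d" "b \<in> Rd d" "?neg b \<in> Rd d" using ab S neg_Rd by auto
      \<comment> \<open>The sum \<open>x + y\<close> is split as
        \<open>(x - a) + (y + b) + (a - b)\<close>; the three norms are less than
        \<open>m/2\<close>, less than \<open>m/2\<close> and at most \<open>L\<close>.\<close>
      let ?z = "\<lambda>i. (vsub (trunc d x) a i + vsub (trunc d y) (?neg b) i) + vsub a b i"
      have eq: "vsub (trunc d (\<lambda>i\<in>{..<d}. (x i + y i) / 2)) (\<lambda>_. 0) = (\<lambda>i. 1/2 * ?z i)"
        by (auto simp: vsub_def trunc_def fun_eq_iff field_simps)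
      have R': "vsub (trunc d x) a \<in> Rd d" "vsub (trunc d y) (?neg b) \<in> Rd d" "vsub a b \<in> Rd d"
        by (intro vsub_in_Rd trunc_in_Rd R)+
      have R'': "(\<lambda>i. vsub (trunc d x) a i + vsub (trunc d y) (?neg b) i) \<in> Rd d" "?z \<in> Rd d"
        using R' by (auto simp: Rd_def)
      have "nrm ?z \<le> nrm (vsub (trunc d x) a) + nrm (vsub (trunc d y) (?neg b)) + nrm (vsub a b)"
        using nrm_triangle[OF R''(1) R'(3)] nrm_triangle[OF R'(1,2)] by linarith
      also have "\<dots> < L + m"
        using ab diam[OF ab(1,2)] by (simp add: nball_def)
      finally have "nrm ?z < L + m" .
      thus ?thesis unfolding nball_def mem_Collect_eq eq nrm_scale[OF R''(2)]
        by (simp add: space_PiM)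
    qed
    thus "indicator ?X x * indicator ?Y y \<le> (indicator ?Z (\<lambda>i\<in>{..<d}. (x i + y i) / 2) :: ennreal)\<^sup>2"
      by (auto simp: indicator_def)
  qed (use meas in auto)
  hence "(ennreal (card S * (m/2) ^ d) * ?v) * (ennreal (card S * (m/2) ^ d) * ?v)
      \<le> (ennreal (((L + m)/2) ^ d) * ?v)\<^sup>2"
    unfolding nn_integral_indicator[OF meas(1)] nn_integral_indicator[OF meas(2)]
      nn_integral_indicator[OF meas(3)] X Y Z .
  moreover obtain w where w: "?v = ennreal w" "0 < w"
    using emeasure_nball_pos emeasure_nball_finite by (cases ?v) auto
  ultimately have "(card S * (m/2) ^ d * w)\<^sup>2 \<le> (((L + m)/2) ^ d * w)\<^sup>2"
    using m L by (simp add: ennreal_mult[symmetric] power2_eq_square)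
  hence "card S * (m/2) ^ d * w \<le> ((L + m)/2) ^ d * w"
    by (rule power2_le_imp_le) (use m L w in auto)
  hence "card S \<le> ((L + m)/2) ^ d / (m/2) ^ d"
    using w m by (simp add: pos_le_divide_eq)
  also have "\<dots> = (L / m + 1) ^ d"
    using m by (simp add: power_divide[symmetric] add_divide_distrib)
  finally show ?thesis .
qed

section \<open>Radius classes of an arrangement\<close>

text \<open>The condition under the supremum in \<open>packing_number\<close>. Being free of minima
  and maxima, it also makes sense for infinite sets, and it holds trivially for subsets of
  \<open>Rd d\<close> with at most one point.\<close>

definition ratio_le :: "real \<Rightarrow> (nat \<Rightarrow> real) set \<Rightarrow> bool" where
  "ratio_le lam S \<longleftrightarrow> S \<subseteq> Rd d \<and>
     (\<forall>a\<in>S. \<forall>b\<in>S. \<forall>c\<in>S. \<forall>e\<in>S. a \<noteq> b \<and> c \<noteq> e \<longrightarrow>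
        nrm (vsub a b) \<le> lam * nrm (vsub c e))"

lemma ratio_leD:
  assumes "ratio_le lam S" "a \<in> S" "b \<in> S" "c \<in> S" "e \<in> S" "a \<noteq> b" "c \<noteq> e"
  shows "nrm (vsub a b) \<le> lam * nrm (vsub c e)"
  using assms unfolding ratio_le_def by simp

lemma packing_number_eq: "packing_number d nrm lam = Sup (esize ` Collect (ratio_le lam))"
  unfolding packing_number_def ratio_le_def by (rule arg_cong[of _ _ Sup]) auto

text \<open>With \<open>m\<close> the smallest distance between distinct points, all distances are
  at most \<open>lam * m\<close>, so the volume bound applies with \<open>L / m = lam\<close>. Sets
  with at most one point have no smallest distance and are treated separately.\<close>

lemma card_ratio_le:
  assumes S: "finite S" "ratio_le lam S" and lam: "lam \<ge> 0"
  shows "real (card S) \<le> (lam + 1) ^ d"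
proof (cases "\<exists>a\<in>S. \<exists>b\<in>S. a \<noteq> b")
  case False
  hence "card S \<le> 1" using card_le_Suc0_iff_eq[OF S(1)] by auto
  moreover have "1 \<le> (lam + 1) ^ d" using lam by simp
  ultimately show ?thesis by linarith
next
  case True
  have R: "S \<subseteq> Rd d" using S by (simp add: ratio_le_def)
  define D where "D = (\<lambda>(a, b). nrm (vsub a b)) ` {(a, b). a \<in> S \<and> b \<in> S \<and> a \<noteq> b}"
  have "finite {(a, b). a \<in> S \<and> b \<in> S \<and> a \<noteq> b}"
    by (rule finite_subset[of _ "S \<times> S"]) (use S in auto)
  hence "finite D" by (simp add: D_def)
  have D_iff: "x \<in> D \<longleftrightarrow> (\<exists>a\<in>S. \<exists>b\<in>S. a \<noteq> b \<and> x = nrm (vsub a b))" for x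
    by (auto simp: D_def)
  obtain a b where "a \<in> S" "b \<in> S" "a \<noteq> b" using True by auto
  hence "nrm (vsub a b) \<in> D" unfolding D_iff by auto
  hence "D \<noteq> {}" by auto
  from Min_in[OF \<open>finite D\<close> this]
  obtain c e where ce: "c \<in> S" "e \<in> S" "c \<noteq> e" "Min D = nrm (vsub c e)"
    unfolding D_iff[of "Min D"] by (elim bexE conjE)
  have ce_Rd: "c \<in> Rd d" "e \<in> Rd d" using ce R by blast+
  have m: "Min D > 0"
    using nrm_nonneg[OF vsub_in_Rd[OF ce_Rd]] nrm_vsub_eq_0_iff[OF ce_Rd] ce by simp
  have "real (card S) \<le> (lam * Min D / Min D + 1) ^ d"
  proof (rule card_separated_le)
    fix a b assume ab: "a \<in> S" "b \<in> S"
    show "Min D \<le> nrm (vsub a b)" if "a \<noteq> b"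
      by (rule Min_le[OF \<open>finite D\<close>]) (use ab that in \<open>auto simp: D_iff\<close>)
    show "nrm (vsub a b) \<le> lam * Min D"
    proof (cases "a = b")
      case True
      thus ?thesis using nrm_0 lam m by (simp add: vsub_def)
    next
      case False
      thus ?thesis unfolding ce(4) by (intro ratio_leD[OF S(2)] ab ce)
    qed
  qed (use S(1) R m lam in simp_all)
  thus ?thesis using m by simp
qed

text \<open>The condition passes to subsets, so an infinite admissible set would contain finite ones
  exceeding the bound.\<close>

lemma packing_number_le:
  assumes "lam \<ge> 0"
  shows "packing_number d nrm lam \<le> ereal ((lam + 1) ^ d)"
  unfolding packing_number_eq
proof (rule SUP_least)
  fix S assume "S \<in> Collect (ratio_le lam)"
  hence S: "ratio_le lam S" by simp
  have "finite S"
  proof (rule ccontr)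
    assume "infinite S"
    obtain n :: nat where n: "(lam + 1) ^ d < real n" using reals_Archimedean2 by blast
    obtain T where T: "T \<subseteq> S" "finite T" "card T = n"
      using infinite_arbitrarily_large[OF \<open>infinite S\<close>] by blast
    hence "ratio_le lam T" using S unfolding ratio_le_def subset_iff by simp
    from card_ratio_le[OF T(2) this assms] T n show False by simp
  qed
  thus "esize S \<le> ereal ((lam + 1) ^ d)"
    using card_ratio_le[OF _ S assms] by (simp add: esize_def)
qed

lemma card_le_packing_number:
  assumes "finite S" "ratio_le lam S"
  shows "ereal (real (card S)) \<le> packing_number d nrm lam"
  unfolding packing_number_eq using assms by (intro SUP_upper2[of S]) (auto simp: esize_def)

text \<open>With unit vectors \<open>u\<close> and \<open>w\<close> in the directions of
  \<open>x\<close> and \<open>y\<close>, one has \<open>x - y = |y| (u - w) + (|x| - |y|) u\<close>.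
  The second summand has norm \<open>|x| - |y|\<close>, so the first must have norm at least
  \<open>|y| - \<delta>\<close>.\<close>

lemma nrm_normalised_diff_ge:
  assumes R: "x \<in> Rd d" "y \<in> Rd d" and pos: "0 < nrm y" "nrm y \<le> nrm x"
    and far: "nrm x - \<delta> \<le> nrm (vsub x y)"
  shows "1 - \<delta> / nrm y \<le> nrm (vsub (\<lambda>i. x i / nrm x) (\<lambda>i. y i / nrm y))"
proof -
  let ?u = "\<lambda>i. x i / nrm x" and ?w = "\<lambda>i. y i / nrm y"
  have U: "?u \<in> Rd d" "?w \<in> Rd d" using R by (auto simp: Rd_def)
  have u1: "nrm ?u = 1" using nrm_scale[OF R(1), of "1 / nrm x"] pos by simp
  have eq: "vsub x y = (\<lambda>i. nrm y * vsub ?u ?w i + (nrm x - nrm y) * ?u i)"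
  proof
    show "vsub x y i = nrm y * vsub ?u ?w i + (nrm x - nrm y) * ?u i" for i
      using pos unfolding vsub_def
      by (simp add: right_diff_distrib left_diff_distrib diff_divide_distrib)
  qed
  have "nrm (vsub x y) \<le> nrm (\<lambda>i. nrm y * vsub ?u ?w i) + nrm (\<lambda>i. (nrm x - nrm y) * ?u i)"
    unfolding eq by (rule nrm_triangle[OF Rd_scale[OF vsub_in_Rd[OF U]] Rd_scale[OF U(1)]])
  also have "\<dots> = nrm y * nrm (vsub ?u ?w) + (nrm x - nrm y)"
    using nrm_scale[OF vsub_in_Rd[OF U], of "nrm y"] nrm_scale[OF U(1), of "nrm x - nrm y"] u1 pos
    by simp
  finally have "nrm y - \<delta> \<le> nrm y * nrm (vsub ?u ?w)" using far by linarith
  hence "(nrm y - \<delta>) / nrm y \<le> nrm (vsub ?u ?w)"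
    using pos by (simp add: pos_divide_le_eq mult.commute)
  thus ?thesis using pos by (simp add: diff_divide_distrib)
qed

end

section \<open>Pairwise intersecting Minkowski arrangements\<close>

locale intersecting_arr = norm_on_Rd +
  fixes A :: "(nat \<Rightarrow> real) set" and r :: "(nat \<Rightarrow> real) \<Rightarrow> real"
  assumes arr: "minkowski_arr d nrm A r" and inter: "pairwise_intersecting d nrm A r"
begin

lemma A_Rd: "A \<subseteq> Rd d" and r_pos: "v \<in> A \<Longrightarrow> 0 < r v"
  using arr by (simp_all add: minkowski_arr_def)

lemma dist_ge:
  assumes "v \<in> A" "w \<in> A" "v \<noteq> w"
  shows "max (r v) (r w) \<le> nrm (vsub v w)"
proof -
  have *: "r y \<le> nrm (vsub x y)" if "x \<in> A" "y \<in> A" "x \<noteq> y" for x y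
    using arr that by (simp add: minkowski_arr_def not_less)
  have R: "v \<in> Rd d" "w \<in> Rd d" using assms A_Rd by blast+
  show ?thesis
    using *[of v w] *[of w v] nrm_vsub_commute[OF R] assms by simp
qed

lemma dist_le:
  assumes "v \<in> A" "w \<in> A"
  shows "nrm (vsub v w) \<le> r v + r w"
proof -
  obtain z where z: "z \<in> Rd d" "nrm (vsub z v) \<le> r v" "nrm (vsub z w) \<le> r w"
    using inter assms unfolding pairwise_intersecting_def by blast
  have R: "v \<in> Rd d" "w \<in> Rd d" using assms A_Rd by auto
  show ?thesis
    using nrm_vsub_triangle[OF R(1) z(1) R(2)] nrm_vsub_commute[OF R(1) z(1)] z by linarith
qed

text \<open>Distinct centres are at least \<open>c\<close> apart by the Minkowski property and at
  most \<open>2 * c * q\<close> apart because the homothets meet.\<close>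

lemma ratio_le_similar_radii:
  assumes B: "B \<subseteq> A" and c: "c > 0" and q: "q \<ge> 0"
    and rad: "\<And>v. v \<in> B \<Longrightarrow> c \<le> r v \<and> r v \<le> c * q"
  shows "ratio_le (2 * q) B"
  unfolding ratio_le_def
proof (intro conjI ballI impI)
  fix v w x y assume vw: "v \<in> B" "w \<in> B" "x \<in> B" "y \<in> B" "v \<noteq> w \<and> x \<noteq> y"
  have "nrm (vsub v w) \<le> c * q + c * q"
  proof -
    have "v \<in> A" "w \<in> A" using vw B by blast+
    thus ?thesis using dist_le[of v w] rad[OF vw(1)] rad[OF vw(2)] by linarith
  qed
  also have "\<dots> = 2 * q * c" by simp
  also have "\<dots> \<le> 2 * q * nrm (vsub x y)"
  proof (rule mult_left_mono)
    have "x \<in> A" "y \<in> A" using vw B by blast+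
    thus "c \<le> nrm (vsub x y)" using dist_ge[of x y] rad[OF vw(3)] vw(5) by simp
  qed (use q in simp)
  finally show "nrm (vsub v w) \<le> 2 * q * nrm (vsub x y)" .
qed (use B A_Rd in auto)

text \<open>Seen from \<open>o'\<close>, the centre \<open>v\<close> lies at a distance
  \<open>?s v\<close> between \<open>r v\<close> and \<open>r v + r o'\<close>. Hence two large
  centres are at least \<open>?s v - r o'\<close> apart, and radial projection leaves them at
  distance at least \<open>1 - r o' / ?s w\<close>, which is at least \<open>d / (d + 1)\<close> as
  \<open>?s w\<close> is at least \<open>(d + 1) * r o'\<close>. Unit vectors are at most 2 apart,
  so the threshold \<open>d + 1\<close> yields exactly the ratio
  \<open>2 * (1 + 1 / d)\<close>.\<close>

lemma card_large_radii:
  assumes fin: "finite A" and o: "o' \<in> A" "\<And>v. v \<in> A \<Longrightarrow> r o' \<le> r v" and d: "d \<ge> 1"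
  shows "ereal (real (card {v \<in> A. (d + 1) * r o' \<le> r v})) \<le> packing_number d nrm (2 * (1 + 1 / d))"
proof -
  let ?B = "{v \<in> A. (d + 1) * r o' \<le> r v}"
  let ?s = "\<lambda>v. nrm (vsub v o')"
  let ?u = "\<lambda>v i. vsub v o' i / ?s v"
  have R: "o' \<in> Rd d" "\<And>v. v \<in> ?B \<Longrightarrow> v \<in> Rd d" using A_Rd o by auto
  have r0: "0 < r o'" using r_pos o by auto
  have s_bounds: "r v \<le> ?s v" "?s v \<le> r v + r o'" "0 < ?s v" if v: "v \<in> ?B" for v
  proof -
    have "r o' < r v"
    proof -
      have "1 * r o' < (d + 1) * r o'" using d r0 by (intro mult_strict_right_mono) auto
      thus ?thesis using v by simp
    qed
    hence "v \<noteq> o'" by auto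
    thus "r v \<le> ?s v" using dist_ge[of v o'] v o by auto
    show "?s v \<le> r v + r o'" using dist_le[of v o'] v o by auto
    show "0 < ?s v" using \<open>r v \<le> ?s v\<close> \<open>r o' < r v\<close> r0 by linarith
  qed
  have u_Rd: "?u v \<in> Rd d" and u_1: "nrm (?u v) = 1" if v: "v \<in> ?B" for v
    using vsub_in_Rd[OF R(2)[OF v] R(1)] nrm_scale[OF vsub_in_Rd[OF R(2)[OF v] R(1)], of "1 / ?s v"] s_bounds(3)[OF v]
    by (simp_all add: Rd_def)
  have sep': "d / (d + 1) \<le> nrm (vsub (?u v) (?u w))"
    if v: "v \<in> ?B" and w: "w \<in> ?B" and ne: "v \<noteq> w" and le: "?s w \<le> ?s v" for v w
  proof -
    have "(d + 1) * r o' \<le> ?s w" using s_bounds(1)[OF w] w by auto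
    hence "r o' / ?s w \<le> 1 / (d + 1)" using s_bounds(3)[OF w] by (simp add: field_simps)
    hence "d / (d + 1) \<le> 1 - r o' / ?s w" by (simp add: field_simps)
    also have "\<dots> \<le> nrm (vsub (?u v) (?u w))"
    proof (rule nrm_normalised_diff_ge)
      have "vsub (vsub v o') (vsub w o') = vsub v w" by (simp add: vsub_def)
      thus "?s v - r o' \<le> nrm (vsub (vsub v o') (vsub w o'))"
        using dist_ge[of v w] s_bounds(2)[OF v] v w ne by auto
    qed (use s_bounds(3)[OF w] le v w R in \<open>auto intro: vsub_in_Rd\<close>)
    finally show ?thesis .
  qed
  have sep: "d / (d + 1) \<le> nrm (vsub (?u v) (?u w))" if "v \<in> ?B" "w \<in> ?B" "v \<noteq> w" for v w
    using sep'[of v w] sep'[of w v] that nrm_vsub_commute[OF u_Rd u_Rd, of v w]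
    by (metis linear)
  \<comment> \<open>The separation is positive, so the projection loses no centres.\<close>
  have inj: "inj_on ?u ?B"
  proof (rule inj_onI, rule ccontr)
    fix v w assume vw: "v \<in> ?B" "w \<in> ?B" "?u v = ?u w" "v \<noteq> w"
    have "d / (d + 1) \<le> 0" using sep[OF vw(1,2,4)] unfolding vw(3) by (simp add: vsub_def nrm_0)
    thus False using d by (simp add: field_simps)
  qed
  have "ratio_le (2 * (1 + 1 / d)) (?u ` ?B)"
    unfolding ratio_le_def
  proof (intro conjI ballI impI)
    show "?u ` ?B \<subseteq> Rd d" using u_Rd by blast
    fix a b x y assume *: "a \<in> ?u ` ?B" "b \<in> ?u ` ?B" "x \<in> ?u ` ?B" "y \<in> ?u ` ?B" "a \<noteq> b \<and> x \<noteq> y"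
    have R: "a \<in> Rd d" "b \<in> Rd d" and 1: "nrm a = 1" "nrm b = 1"
      using * u_Rd u_1 by blast+
    have 0: "(\<lambda>_. 0) \<in> Rd d" by (simp add: Rd_def)
    have "nrm (vsub a b) \<le> nrm a + nrm b"
      using nrm_vsub_triangle[OF R(1) 0 R(2)] nrm_vsub_commute[OF 0 R(2)] by (simp add: vsub_def)
    also have "\<dots> = 2 * (1 + 1 / d) * (d / (d + 1))"
    proof -
      have "(1 + 1 / d) * (d / (d + 1)) = 1" using d by (simp add: divide_simps)
      thus ?thesis using 1 by (simp only: mult.assoc)
    qed
    also have "d / (d + 1) \<le> nrm (vsub x y)" using * sep by blast
    finally show "nrm (vsub a b) \<le> 2 * (1 + 1 / d) * nrm (vsub x y)"
      using d by (simp add: mult_left_mono)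
  qed
  from card_le_packing_number[OF _ this] fin show ?thesis
    unfolding card_image[OF inj] by simp
qed

text \<open>The radii below \<open>d + 1\<close> times the smallest are sorted into geometric
  classes of ratio \<open>q = 1 + 1 / d\<close>; each class, and the set of large radii, has at most
  \<open>p\<close> members.\<close>

lemma card_le:
  assumes fin: "finite A" and d: "d \<ge> 1"
    and p: "packing_number d nrm (2 * (1 + 1 / d)) = ereal p"
  shows "real (card A) \<le> (ln (d + 1) / ln (1 + 1 / d) + 2) * p"
proof (cases "A = {}")
  case True
  have "0 \<le> p" using card_le_packing_number[of "{}" "2 * (1 + 1 / d)"] p by (simp add: ratio_le_def)
  thus ?thesis using True d by (auto intro!: mult_nonneg_nonneg add_nonneg_nonneg divide_nonneg_nonneg)
next
  case False
  define q where "q = 1 + 1 / real d"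
  have q: "q > 1" using d by (simp add: q_def)
  obtain o' where o: "o' \<in> A" "\<And>v. v \<in> A \<Longrightarrow> r o' \<le> r v"
    using arg_min_if_finite[OF fin False, of r] by (metis linorder_not_less)
  have r0: "0 < r o'" using r_pos o by auto
  define N where "N = nat \<lfloor>log q (d + 1)\<rfloor>"
  \<comment> \<open>Class \<open>j\<close> holds the radii from \<open>q^j\<close> up to
    \<open>q^(j+1)\<close> times the smallest. The logarithm is nonnegative by the choice of
    \<open>o'\<close>, so \<open>nat\<close> loses nothing.\<close>
  define k where "k v = nat \<lfloor>log q (r v / r o')\<rfloor>" for v
  define B where "B j = {v \<in> A. r v < (d + 1) * r o' \<and> k v = j}" for j
  let ?C = "{v \<in> A. (d + 1) * r o' \<le> r v}"
  have "0 \<le> log q (d + 1)" using q by simp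
  have log_nonneg: "0 \<le> log q (r v / r o')" if "v \<in> A" for v
    using o(2)[OF that] r0 q by simp
  have "A \<subseteq> (\<Union>j\<in>{..N}. B j) \<union> ?C"
  proof
    fix v assume v: "v \<in> A"
    have "k v \<le> N" if "r v < (d + 1) * r o'"
      unfolding k_def N_def
      by (intro nat_mono floor_mono) (use that r0 q v r_pos in \<open>auto simp: field_simps\<close>)
    thus "v \<in> (\<Union>j\<in>{..N}. B j) \<union> ?C" using v by (auto simp: B_def)
  qed
  hence "card A \<le> card ((\<Union>j\<in>{..N}. B j) \<union> ?C)"
    using fin by (intro card_mono) (auto simp: B_def)
  also have "\<dots> \<le> card (\<Union>j\<in>{..N}. B j) + card ?C" by (rule card_Un_le)
  also have "\<dots> \<le> (\<Sum>j\<le>N. card (B j)) + card ?C" using card_UN_le[of "{..N}" B] by simp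
  finally have "real (card A) \<le> (\<Sum>j\<le>N. real (card (B j))) + real (card ?C)"
    by (simp flip: of_nat_sum of_nat_add)
  also have "\<dots> \<le> (\<Sum>j\<le>N. p) + p"
  proof (intro add_mono sum_mono)
    show "real (card ?C) \<le> p" using card_large_radii[OF fin o d] p by simp
    fix j
    have "ratio_le (2 * q) (B j)"
    proof (rule ratio_le_similar_radii)
      fix v assume v: "v \<in> B j"
      have vA: "v \<in> A" using v by (simp add: B_def)
      have j: "real j = of_int \<lfloor>log q (r v / r o')\<rfloor>"
        using v log_nonneg[OF vA] by (auto simp: B_def k_def)
      have pos: "r v / r o' > 0" using r_pos[OF vA] r0 by simp
      have "real j \<le> log q (r v / r o')" "log q (r v / r o') < real j + 1" unfolding j by linarith+
      hence "q powr j \<le> r v / r o'" "r v / r o' < q powr (j + 1)"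
        using q pos by (simp_all add: le_log_iff log_less_iff add.commute)
      thus "q powr j * r o' \<le> r v \<and> r v \<le> q powr j * r o' * q"
        using r0 q by (simp add: powr_add field_simps)
    qed (use q r0 in \<open>auto simp: B_def\<close>)
    moreover have "finite (B j)" using fin by (simp add: B_def)
    ultimately show "real (card (B j)) \<le> p"
      using card_le_packing_number[of "B j" "2 * q"] p by (simp add: q_def)
  qed
  \<comment> \<open>There are \<open>N + 1\<close> classes, indexed from 0 to \<open>N\<close>, and
    one more for the large radii.\<close>
  also have "\<dots> = (real N + 2) * p" by (simp add: algebra_simps)
  also have "\<dots> \<le> (ln (d + 1) / ln (1 + 1 / d) + 2) * p"
  proof (rule mult_right_mono)
    show "real N + 2 \<le> ln (d + 1) / ln (1 + 1 / d) + 2"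
      using \<open>0 \<le> log q (d + 1)\<close> by (simp add: N_def log_def q_def)
    show "0 \<le> p" using card_le_packing_number[of "{}" "2 * (1 + 1 / d)"] p by (simp add: ratio_le_def)
  qed
  finally show ?thesis .
qed

end

section \<open>Numerical estimates and conclusion\<close>

lemma radius_class_count_le:
  assumes "d \<ge> (2::nat)"
  shows "ln (d + 1) / ln (1 + 1 / d) + 2 \<le> (d + 7) * ln d"
proof -
  have d: "real d \<ge> 2" using assms by simp
  have "- ln (1 + 1 / d) = ln (1 / (1 + 1 / d))" using d by (simp add: ln_div)
  also have "\<dots> \<le> 1 / (1 + 1 / d) - 1" using d by (intro ln_le_minus_one) (auto intro: divide_pos_pos add_pos_pos)
  also have "\<dots> = - 1 / (d + 1)" using d by (simp add: field_simps)
  finally have low: "1 / (d + 1) \<le> ln (1 + 1 / d)" by simp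
  have "ln (d + 1) = ln d + ln (1 + 1 / d)"
  proof -
    have "1 + 1 / real d > 0" using d by (simp add: add_pos_pos)
    moreover have "real (d + 1) = d * (1 + 1 / d)" using d by (simp add: distrib_left)
    ultimately show ?thesis using d ln_mult_pos[of "real d" "1 + 1 / d"] by simp
  qed
  also have "ln (1 + 1 / real d) \<le> 1 / d" using d by (intro ln_add_one_self_le_self) auto
  finally have up: "ln (d + 1) \<le> ln d + 1 / d" by simp
  have "ln (d + 1) / ln (1 + 1 / d) \<le> (ln d + 1 / d) / (1 / (d + 1))"
    using d up low by (intro frac_le) auto
  also have "\<dots> = (d + 1) * ln d + 1 + 1 / d" using d by (simp add: field_simps)
  also have "1 / d \<le> 1 / 2" using d by (simp add: field_simps)
  finally have 1: "ln (d + 1) / ln (1 + 1 / d) \<le> (d + 1) * ln d + 3 / 2" by simp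
  \<comment> \<open>The leftover constant \<open>3/2 + 2\<close> is absorbed by
    \<open>6 * ln d\<close>, which is at least 4; this explains the 7 in
    \<open>d + 7\<close>.\<close>
  have "2 / 3 \<le> ln (real d)"
    using ln2_ge_two_thirds d by (meson ln_le_cancel_iff order_trans zero_less_numeral order_less_le_trans)
  thus ?thesis using 1 by (simp add: algebra_simps)
qed

text \<open>The base is \<open>3 * (1 + 2 / (3 * d))\<close>, and the \<open>d\<close>-th power of
  the second factor is at most \<open>exp (2 / 3)\<close>, hence at most 3.\<close>

lemma packing_base_power_le:
  assumes "d \<ge> (1::nat)"
  shows "(2 * (1 + 1 / d) + 1) ^ d \<le> 3 * (3::real) ^ d"
proof -
  have "2 * (1 + 1 / d) + 1 = 3 * (1 + 2 / (3 * real d))" using assms by (simp add: field_simps)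
  hence "(2 * (1 + 1 / d) + 1) ^ d = 3 ^ d * (1 + 2 / (3 * real d)) ^ d" by (simp only: power_mult_distrib)
  also have "(1 + 2 / (3 * real d)) ^ d \<le> exp (2 / (3 * real d)) ^ d"
    by (intro power_mono exp_ge_add_one_self) auto
  also have "\<dots> = exp (2 / 3)" using assms by (simp flip: exp_of_nat_mult)
  also have "\<dots> \<le> exp 1" by simp
  also have "\<dots> \<le> 3" by (rule exp_le)
  finally show ?thesis by simp
qed

theorem theorem9:
  "\<exists>C1 C2 :: real. \<forall>d::nat. \<forall>nrm. d \<ge> 2 \<longrightarrow> is_norm_on d nrm \<longrightarrow>
     kappa' d nrm \<le> kappa d nrm \<and>
     kappa d nrm \<le> packing_number d nrm (2 * (1 + 1 / real d)) * ereal ((real d + C1) * ln (real d)) \<and>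
     packing_number d nrm (2 * (1 + 1 / real d)) * ereal ((real d + C1) * ln (real d))
       \<le> ereal (C2 * 3 ^ d * real d * ln (real d))"
proof (rule exI[of _ 7], rule exI[of _ 14], intro allI impI)
  fix d :: nat and nrm
  assume d: "d \<ge> 2" and "is_norm_on d nrm"
  then interpret norm_on_Rd d nrm by unfold_locales
  let ?P = "packing_number d nrm (2 * (1 + 1 / real d))"
  have le: "?P \<le> ereal ((2 * (1 + 1 / d) + 1) ^ d)"
    by (rule packing_number_le) simp
  moreover have ge: "ereal 0 \<le> ?P"
    using card_le_packing_number[of "{}" "2 * (1 + 1 / d)"] by (simp add: ratio_le_def)
  ultimately obtain p where p: "?P = ereal p" by (cases ?P) auto
  have p0: "0 \<le> p" using ge p by simp
  have p3: "p \<le> 3 * 3 ^ d"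
    using le packing_base_power_le[of d] d unfolding p by simp
  have ln0: "0 \<le> ln (real d)" using d by simp
  have finite_bound: "real (card A) \<le> p * ((d + 7) * ln d)"
    if "finite A" "minkowski_arr d nrm A r" "pairwise_intersecting d nrm A r" for A r
  proof -
    interpret intersecting_arr d nrm A r by unfold_locales fact+
    have "real (card A) \<le> (ln (d + 1) / ln (1 + 1 / d) + 2) * p"
      using card_le[OF that(1) _ p] d by simp
    also have "\<dots> \<le> ((d + 7) * ln d) * p"
      by (intro mult_right_mono radius_class_count_le d p0)
    finally show ?thesis by (simp add: mult.commute)
  qed
  have "kappa' d nrm \<le> kappa d nrm"
    unfolding kappa_def kappa'_def
  proof (rule Sup_subset_mono)
    have "minkowski_arr d nrm A r" if "strict_minkowski_arr d nrm A r" for A r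
      using that unfolding minkowski_arr_def strict_minkowski_arr_def by (meson less_imp_le)
    thus "{esize A |A r. strict_minkowski_arr d nrm A r \<and> pairwise_intersecting d nrm A r}
        \<subseteq> {esize A |A r. minkowski_arr d nrm A r \<and> pairwise_intersecting d nrm A r}" by blast
  qed
  moreover have "kappa d nrm \<le> ?P * ereal ((real d + 7) * ln (real d))"
    unfolding kappa_def
  proof (rule Sup_least, clarify)
    fix A r assume A: "minkowski_arr d nrm A r" "pairwise_intersecting d nrm A r"
    \<comment> \<open>Both properties pass to subfamilies, so an infinite arrangement would contain
      finite ones violating the bound.\<close>
    have "finite A"
    proof (rule ccontr)
      assume inf: "infinite A"
      obtain n :: nat where n: "p * ((d + 7) * ln d) < real n" using reals_Archimedean2 by blast
      obtain T where T: "T \<subseteq> A" "finite T" "card T = n"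
        using infinite_arbitrarily_large[OF inf] by blast
      have "minkowski_arr d nrm T r"
        using A(1) T(1) unfolding minkowski_arr_def subset_iff by simp
      moreover have "pairwise_intersecting d nrm T r"
        using A(2) T(1) unfolding pairwise_intersecting_def subset_iff by simp
      ultimately have "real (card T) \<le> p * ((d + 7) * ln d)"
        by (rule finite_bound[OF T(2)])
      thus False using T(3) n by linarith
    qed
    from finite_bound[OF this A] this show "esize A \<le> ?P * ereal ((real d + 7) * ln (real d))"
      unfolding p by (simp add: esize_def)
  qed
  moreover have "?P * ereal ((real d + 7) * ln (real d)) \<le> ereal (14 * 3 ^ d * real d * ln (real d))"
  proof -
    \<comment> \<open>For \<open>d\<close> at least 2, \<open>d + 7\<close> is at most
      \<open>14 / 3 * d\<close>; with the factor 3 from the bound on \<open>p\<close> this gives the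
      constant 14.\<close>
    have "p * ((real d + 7) * ln d) \<le> (3 * 3 ^ d) * ((14 / 3 * real d) * ln d)"
      using p3 p0 d ln0 by (intro mult_mono mult_right_mono) auto
    thus ?thesis unfolding p by (simp add: mult_ac)
  qed
  ultimately show "kappa' d nrm \<le> kappa d nrm \<and>
     kappa d nrm \<le> ?P * ereal ((real d + 7) * ln (real d)) \<and>
     ?P * ereal ((real d + 7) * ln (real d)) \<le> ereal (14 * 3 ^ d * real d * ln (real d))" by blast
qed

end
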